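(* Let $\beta>1$ be real and let $m$ be a positive integer with $m\ge\beta-1$. Let $D$ be a nonnegative integer valued random variable and, for $p\in(0,1)$, let $S_D$ denote the $p$-thinning of $D$. Suppose that for every integer $k\ge\beta$, $$\lim_{p\to 0+}\frac{\mathbb{P}(S_D=k)}{\mathbb{P}(S_D=k-1)}=\frac{k-\beta}{k}.$$ Then the conditional distributions of $S_D$ given $S_D\ge m$ are tight as $p\downarrow0$, i.e. $$\lim_{k\to\infty}\limsup_{p\to0+}\frac{\mathbb{P}(S_D\ge k)}{\mathbb{P}(S_D\ge m)}=0.$$ It follows that these conditional distributions have a limit (in distribution) as $p\downarrow0$. In case $\beta<m+1$, the limit is the unique probability distribution $\mu$ on $\{m,m+1,m+2,\dots\}$ with $\mu(m)>0$ and $$\frac{\mu(k+1)}{\mu(k)}=\frac{k-\alpha}{k+1}\quad\text{for all integers } k\ge m,\qquad \alpha=\beta-1;$$ in case $\beta=m+1$, the limit is the point mass at $m$.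
   Context: For a nonnegative integer valued random variable $D$ and $p\in(0,1)$, the $p$-thinning of $D$ is $S_D=\sum_{i=1}^{D}X_i$, where $X_1,X_2,\dots$ are i.i.d. Bernoulli($p$) random variables independent of $D$ (the dependence of $S_D$ on $p$ is suppressed in the notation). The hypothesis on the limits of ratios includes that the ratios are defined, i.e. the denominators are positive. *)

theory Defs
  imports "HOL-Probability.Probability"
begin

text \<open>
  The law of the \<open>p\<close>-thinning of \<open>D\<close>. The i.i.d. Bernoulli sequence lives on the infinite product
  space, so that the product with the space of \<open>D\<close> makes it independent of \<open>D\<close> whatever that space
  is. By \<open>thinning_law_realization\<close> below, every other realization has the same law.
\<close>

definition thinning_law :: "'a measure \<Rightarrow> ('a \<Rightarrow> nat) \<Rightarrow> real \<Rightarrow> nat measure" where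
  "thinning_law M D p =
     distr (M \<Otimes>\<^sub>M (\<Pi>\<^sub>M i\<in>(UNIV :: nat set). measure_pmf (bernoulli_pmf p))) (count_space UNIV)
       (\<lambda>(\<omega>, x). \<Sum>i = 1..D \<omega>. of_bool (x i))"

definition thinning_cond_law :: "'a measure \<Rightarrow> ('a \<Rightarrow> nat) \<Rightarrow> nat \<Rightarrow> real \<Rightarrow> nat measure" where
  "thinning_cond_law M D m p = uniform_measure (thinning_law M D p) {m..}"

text \<open>
  Convergence in distribution along an arbitrary filter; the library's \<open>weak_conv_m\<close> is the
  special case of sequences.
\<close>

definition conv_in_distribution :: "('i \<Rightarrow> real measure) \<Rightarrow> real measure \<Rightarrow> 'i filter \<Rightarrow> bool" where
  "conv_in_distribution N L F \<longleftrightarrow>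
     (\<forall>x. isCont (cdf L) x \<longrightarrow> ((\<lambda>i. cdf (N i) x) \<longlongrightarrow> cdf L x) F)"

lemma conv_in_distribution_sequentially:
  "conv_in_distribution N L sequentially \<longleftrightarrow> weak_conv_m N L"
  by (simp add: conv_in_distribution_def weak_conv_m_def weak_conv_def)

text \<open>
  The convention \<open>x / 0 = 0\<close> is harmless for \<open>\<alpha> < m\<close>: the prescribed ratios are then positive,
  so every \<open>pmf \<mu> k\<close> with \<open>k \<ge> m\<close> is.
\<close>

definition has_ratio_law :: "nat \<Rightarrow> real \<Rightarrow> nat pmf \<Rightarrow> bool" where
  "has_ratio_law m \<alpha> \<mu> \<longleftrightarrow> set_pmf \<mu> \<subseteq> {m..} \<and> pmf \<mu> m > 0 \<and>
     (\<forall>k\<ge>m. pmf \<mu> (k + 1) / pmf \<mu> k = (real k - \<alpha>) / (real k + 1))"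

definition nat_conv_in_distribution :: "('i \<Rightarrow> nat measure) \<Rightarrow> nat pmf \<Rightarrow> 'i filter \<Rightarrow> bool" where
  "nat_conv_in_distribution N \<mu> F \<longleftrightarrow>
     conv_in_distribution (\<lambda>i. distr (N i) borel real) (distr (measure_pmf \<mu>) borel real) F"

lemma thinning_law_realization:
  fixes D :: "'a \<Rightarrow> nat" and X :: "nat \<Rightarrow> 'a \<Rightarrow> bool"
  assumes "prob_space M"
    and X: "prob_space.indep_vars M (\<lambda>_. count_space UNIV) X UNIV"
    and bern: "\<And>i. distr M (count_space UNIV) (X i) = measure_pmf (bernoulli_pmf p)"
    and D[measurable]: "D \<in> measurable M (count_space UNIV)"
    and indep: "distr M (count_space UNIV \<Otimes>\<^sub>M (\<Pi>\<^sub>M i\<in>UNIV. count_space UNIV)) (\<lambda>\<omega>. (D \<omega>, \<lambda>i. X i \<omega>)) =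
          distr M (count_space UNIV) D \<Otimes>\<^sub>M
          distr M (\<Pi>\<^sub>M i\<in>UNIV. count_space UNIV) (\<lambda>\<omega> i. X i \<omega>)"
  shows "distr M (count_space UNIV) (\<lambda>\<omega>. \<Sum>i = 1..D \<omega>. of_bool (X i \<omega>)) = thinning_law M D p"
proof -
  interpret prob_space M by fact
  let ?B = "\<Pi>\<^sub>M i\<in>(UNIV :: nat set). measure_pmf (bernoulli_pmf p)"
  let ?C = "\<Pi>\<^sub>M i\<in>(UNIV :: nat set). count_space (UNIV :: bool set)"
  let ?f = "\<lambda>(d, x). \<Sum>i = 1..(d::nat). of_bool (x i) :: nat"
  have rv: "X i \<in> measurable M (count_space UNIV)" for i
    using X by (auto simp: indep_vars_def)
  have Xs[measurable]: "(\<lambda>\<omega> i. X i \<omega>) \<in> measurable M ?C"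
    using rv by (intro measurable_PiM_single') auto
  have setsB: "sets ?B = sets ?C"
    by (intro sets_PiM_cong) auto
  have lawX: "distr M ?C (\<lambda>\<omega> i. X i \<omega>) = ?B"
  proof -
    have "distr M ?C (\<lambda>\<omega>. \<lambda>i\<in>UNIV. X i \<omega>) =
          (\<Pi>\<^sub>M i\<in>UNIV. distr M (count_space UNIV) (X i))"
      using X rv by (subst indep_vars_iff_distr_eq_PiM[symmetric]) auto
    then show ?thesis
      by (simp add: bern restrict_def)
  qed
  interpret B: prob_space ?B
    by (intro prob_space_PiM) (simp add: measure_pmf.prob_space_axioms)
  have f: "?f \<in> measurable (count_space UNIV \<Otimes>\<^sub>M ?C) (count_space UNIV)"
    by measurable
  have joint: "distr M (count_space UNIV \<Otimes>\<^sub>M ?C) (\<lambda>\<omega>. (D \<omega>, \<lambda>i. X i \<omega>)) =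
        distr M (count_space UNIV) D \<Otimes>\<^sub>M ?B"
    using indep unfolding lawX .
  have pair: "distr M (count_space UNIV) D \<Otimes>\<^sub>M ?B =
        distr (M \<Otimes>\<^sub>M ?B) (count_space UNIV \<Otimes>\<^sub>M ?C) (\<lambda>(\<omega>, x). (D \<omega>, x))"
  proof -
    have "distr M (count_space UNIV) D \<Otimes>\<^sub>M distr ?B ?C (\<lambda>x. x) =
        distr (M \<Otimes>\<^sub>M ?B) (count_space UNIV \<Otimes>\<^sub>M ?C) (\<lambda>(\<omega>, x). (D \<omega>, x))"
      by (intro pair_measure_distr)
        (auto simp: distr_id2 setsB B.sigma_finite_measure_axioms
          intro: measurable_ident_sets)
    then show ?thesis
      by (simp add: distr_id2 setsB)
  qed
  have "distr M (count_space UNIV) (\<lambda>\<omega>. \<Sum>i = 1..D \<omega>. of_bool (X i \<omega>)) =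
        distr (distr M (count_space UNIV \<Otimes>\<^sub>M ?C) (\<lambda>\<omega>. (D \<omega>, \<lambda>i. X i \<omega>))) (count_space UNIV) ?f"
    by (subst distr_distr[OF f]) (auto simp: comp_def)
  also have "\<dots> = thinning_law M D p"
  proof -
    have g: "(\<lambda>(\<omega>, x). (D \<omega>, x)) \<in> measurable (M \<Otimes>\<^sub>M ?B) (count_space UNIV \<Otimes>\<^sub>M ?C)"
      using measurable_ident_sets[OF setsB] by measurable
    show ?thesis
      unfolding joint pair thinning_law_def
      by (subst distr_distr[OF f g]) (auto simp: comp_def case_prod_unfold)
  qed
  finally show ?thesis .
qed

end

theory Submission
  imports Defs
begin

text \<open>
  Write \<open>f\<^sub>k(p) = P(S = k)\<close> and \<open>F\<^sub>k(p) = P(S \<ge> k)\<close> for the \<open>p\<close>-thinning \<open>S\<close> of \<open>D\<close>, and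
  \<open>\<alpha> = \<beta> - 1\<close>. Retaining each of the \<open>D\<close> points independently gives
  \<open>f\<^sub>k(p) = (p\<^sup>k / k!) G\<^sup>(\<^sup>k\<^sup>)(1 - p)\<close> with \<open>G\<close> the generating function of \<open>D\<close>, and therefore
  \<open>p f\<^sub>k' = k f\<^sub>k - (k + 1) f\<^sub>k\<^sub>+\<^sub>1\<close>; summing these equations telescopes to \<open>p F\<^sub>k' = k f\<^sub>k\<close>.

  For \<open>k \<ge> m\<close> the hypothesis on the ratios says that \<open>p f\<^sub>k' / f\<^sub>k\<close> tends to
  \<open>k - (k + 1 - \<beta>) = \<alpha> > 0\<close>, a value that does not depend on \<open>k\<close>. Both \<open>f\<^sub>k\<close> and \<open>F\<^sub>k\<close> vanish as
  \<open>p \<down> 0\<close>, because \<open>k \<ge> 1\<close>. So L'Hopital's rule applies to \<open>F\<^sub>k / f\<^sub>k\<close> and gives the limit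
  \<open>k / \<alpha>\<close> (\<open>tail_over_mass_tendsto\<close>). This step controls the whole tail by a single mass, which
  the ratios of masses alone cannot do. Since \<open>F\<^sub>k\<^sub>+\<^sub>1 = F\<^sub>k - f\<^sub>k\<close>, it follows that
  \<open>F\<^sub>k\<^sub>+\<^sub>1 / F\<^sub>k\<close> tends to \<open>1 - \<alpha> / k\<close>, and by multiplication \<open>F\<^sub>k / F\<^sub>m\<close> tends to
  \<open>T\<^sub>k = (1 - \<alpha> / m) \<dots> (1 - \<alpha> / (k - 1))\<close>.

  The numbers \<open>T\<^sub>k\<close> decrease to \<open>0\<close> because the harmonic series diverges
  (\<open>ratio_tail_tendsto_0\<close>). This is tightness, and it makes \<open>T\<close> the tail function of a probability
  law, which is the limit of the conditional laws. Its mass at \<open>k \<ge> m\<close> is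
  \<open>T\<^sub>k - T\<^sub>k\<^sub>+\<^sub>1 = T\<^sub>k \<alpha> / k\<close>. For \<open>\<alpha> < m\<close> these masses have the prescribed ratios; for \<open>\<alpha> = m\<close> the
  first factor of \<open>T\<^sub>k\<close> vanishes and the law is the point mass at \<open>m\<close>.
\<close>


section \<open>Thinned masses as power series\<close>

text \<open>
  The sequence \<open>a\<close> stands for the law of \<open>D\<close>. The series is that of \<open>P(S = k)\<close> with the terms
  \<open>n < k\<close>, which vanish, left out and the power \<open>p\<^sup>k\<close> pulled out, so that what remains is a genuine
  power series in \<open>1 - p\<close>: the \<open>k\<close>-th derivative of the generating function of \<open>a\<close> divided by \<open>k!\<close>.
\<close>

definition thinned_mass :: "(nat \<Rightarrow> real) \<Rightarrow> nat \<Rightarrow> real \<Rightarrow> real" where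
  "thinned_mass a k p = p ^ k * (\<Sum>j. a (j + k) * real ((j + k) choose k) * (1 - p) ^ j)"

text \<open>Termwise differentiation leads from the power series for \<open>k\<close> to that for \<open>k + 1\<close>.\<close>

lemma diffs_binomial_weights:
  fixes a :: "nat \<Rightarrow> real"
  shows "diffs (\<lambda>j. a (j + k) * real ((j + k) choose k)) =
    (\<lambda>j. real (Suc k) * (a (j + Suc k) * real ((j + Suc k) choose Suc k)))"
proof
  fix j
  have "Suc j * (Suc (j + k) choose k) = Suc k * (Suc (j + k) choose Suc k)"
    using binomial_absorb_comp[of "Suc (j + k)" k] binomial_absorption[of k "Suc (j + k)"]
    by (simp add: Suc_diff_le)
  then have "real (Suc j) * real (Suc (j + k) choose k) = real (Suc k) * real (Suc (j + k) choose Suc k)"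
    by (metis of_nat_mult)
  then show "diffs (\<lambda>j. a (j + k) * real ((j + k) choose k)) j =
      real (Suc k) * (a (j + Suc k) * real ((j + Suc k) choose Suc k))"
    by (simp add: diffs_def algebra_simps del: binomial_Suc_Suc of_nat_Suc)
qed

lemma summable_binomial_weights:
  fixes a :: "nat \<Rightarrow> real"
  assumes "summable (\<lambda>n. \<bar>a n\<bar>)" and "\<bar>x\<bar> < 1"
  shows "summable (\<lambda>j. a (j + k) * real ((j + k) choose k) * x ^ j)"
  using \<open>\<bar>x\<bar> < 1\<close>
proof (induction k arbitrary: x)
  case 0
  show ?case
  proof (rule summable_comparison_test')
    show "summable (\<lambda>n. \<bar>a n\<bar>)" by fact
    show "norm (a (j + 0) * real ((j + 0) choose 0) * x ^ j) \<le> \<bar>a j\<bar>" for j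
      using 0 by (simp add: abs_mult power_abs mult_left_le power_le_one)
  qed
next
  case (Suc k)
  have "summable (\<lambda>j. diffs (\<lambda>j. a (j + k) * real ((j + k) choose k)) j * x ^ j)"
    using Suc by (intro termdiff_converges[where K = 1]) auto
  then have "summable (\<lambda>j. real (Suc k) * (a (j + Suc k) * real ((j + Suc k) choose Suc k) * x ^ j))"
    by (simp only: diffs_binomial_weights mult.assoc)
  then show ?case
    by (subst (asm) summable_cmult_iff) auto
qed

lemma DERIV_thinned_mass:
  fixes a :: "nat \<Rightarrow> real"
  assumes a: "summable (\<lambda>n. \<bar>a n\<bar>)" and p: "0 < p" "p < 1"
  shows "DERIV (thinned_mass a k) p :>
    (real k * thinned_mass a k p - real (Suc k) * thinned_mass a (Suc k) p) / p"
proof -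
  let ?c = "\<lambda>k j. a (j + k) * real ((j + k) choose k)"
  let ?g = "\<lambda>k x. \<Sum>j. ?c k j * x ^ j"
  define K where "K = 1 - p / 2"
  have "DERIV (?g k) (1 - p) :> (\<Sum>j. diffs (?c k) j * (1 - p) ^ j)"
    using p summable_binomial_weights[OF a, of K k]
    by (intro termdiffs_strong[where K = K]) (auto simp: K_def)
  also have "(\<Sum>j. diffs (?c k) j * (1 - p) ^ j) = real (Suc k) * ?g (Suc k) (1 - p)"
    unfolding diffs_binomial_weights mult.assoc[of "real (Suc k)"]
    using summable_binomial_weights[OF a, of "1 - p" "Suc k"] p
    by (intro suminf_mult) auto
  finally have g: "DERIV (?g k) (1 - p) :> real (Suc k) * ?g (Suc k) (1 - p)" .
  have "DERIV (\<lambda>p. 1 - p) p :> -1"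
    by (auto intro!: derivative_eq_intros)
  from DERIV_chain2[OF g this]
  have g': "DERIV (\<lambda>p. ?g k (1 - p)) p :> - (real (Suc k) * ?g (Suc k) (1 - p))"
    by simp
  have "DERIV (\<lambda>p. p ^ k * ?g k (1 - p)) p :>
      real k * p ^ (k - 1) * ?g k (1 - p) + - (real (Suc k) * ?g (Suc k) (1 - p)) * p ^ k"
    using DERIV_mult[OF DERIV_pow[of k p] g'] by simp
  moreover have "real k * p ^ (k - 1) = real k * p ^ k / p"
    using p by (cases k) auto
  ultimately have "DERIV (thinned_mass a k) p :>
      real k * p ^ k / p * ?g k (1 - p) + - (real (Suc k) * ?g (Suc k) (1 - p)) * p ^ k"
    unfolding thinned_mass_def[abs_def] by metis
  moreover have "real k * p ^ k / p * ?g k (1 - p) + - (real (Suc k) * ?g (Suc k) (1 - p)) * p ^ k =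
      (real k * thinned_mass a k p - real (Suc k) * thinned_mass a (Suc k) p) / p"
    using p unfolding thinned_mass_def
    by (simp add: field_simps del: binomial_Suc_Suc of_nat_Suc)
  ultimately show ?thesis
    by simp
qed

text \<open>
  The value \<open>x = 1\<close> may lie on the boundary of the disc of convergence. Absolute summability of the
  coefficients makes the convergence uniform up to this point.
\<close>

lemma thinned_mass_0_tendsto:
  fixes a :: "nat \<Rightarrow> real"
  assumes "summable (\<lambda>n. \<bar>a n\<bar>)"
  shows "(thinned_mass a 0 \<longlongrightarrow> (\<Sum>n. a n)) (at_right 0)"
proof -
  have "continuous_on {0..1} (\<lambda>x. \<Sum>n. a n * x ^ n)"
  proof (rule uniform_limit_theorem)
    show "uniform_limit {0..1} (\<lambda>N x. \<Sum>n<N. a n * x ^ n) (\<lambda>x. \<Sum>n. a n * x ^ n) sequentially"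
      using assms
      by (intro Weierstrass_m_test[where M = "\<lambda>n. \<bar>a n\<bar>"])
        (auto simp: abs_mult power_abs mult_left_le power_le_one)
  qed (auto intro!: continuous_intros always_eventually)
  moreover have "((\<lambda>p. 1 - p) \<longlongrightarrow> (1::real)) (at_right 0)"
    by (auto intro!: tendsto_eq_intros)
  moreover have "\<forall>\<^sub>F p in at_right 0. 1 - p \<in> {0..1::real}"
    using eventually_at_right_real[of 0 1] by (auto elim!: eventually_mono)
  ultimately have "((\<lambda>p. \<Sum>n. a n * (1 - p) ^ n) \<longlongrightarrow> (\<Sum>n. a n * 1 ^ n)) (at_right 0)"
    by (intro continuous_on_tendsto_compose[where f = "\<lambda>x. \<Sum>n. a n * x ^ n"]) auto
  then show ?thesis
    by (simp add: thinned_mass_def[abs_def])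
qed


section \<open>The law of the thinning\<close>

lemma measurable_PiM_bernoulli_component:
  "(\<lambda>x. x i) \<in> measurable (\<Pi>\<^sub>M i\<in>(UNIV :: nat set). measure_pmf (bernoulli_pmf p)) (count_space UNIV)"
  using measurable_component_singleton[of i UNIV "\<lambda>_. measure_pmf (bernoulli_pmf p)"]
  by (simp add: measurable_def)

text \<open>
  The binomial distribution for the coordinates of the infinite product: the event splits into
  cylinders, one for each set of \<open>k\<close> indices
  among the first \<open>n\<close>.
\<close>

lemma measure_bernoulli_count:
  fixes p :: real
  assumes p: "0 < p" "p < 1"
  shows "measure (\<Pi>\<^sub>M i\<in>(UNIV :: nat set). measure_pmf (bernoulli_pmf p))
      {x. (\<Sum>i = 1..n. of_bool (x i)) = k} = real (n choose k) * p ^ k * (1 - p) ^ (n - k)"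
proof -
  let ?B = "\<Pi>\<^sub>M i\<in>(UNIV :: nat set). measure_pmf (bernoulli_pmf p)"
  interpret product_prob_space "\<lambda>_. measure_pmf (bernoulli_pmf p)" "UNIV :: nat set"
    by unfold_locales
  \<comment> \<open>the cylinder on which the successes among the first \<open>n\<close> trials are exactly those in \<open>A\<close>\<close>
  define C where "C A = {x. \<forall>i\<in>{1..n}. x i \<in> {i \<in> A}}" for A :: "nat set"
  define \<A> where "\<A> = {A. A \<subseteq> {1..n} \<and> card A = k}"
  have fin: "finite \<A>"
    unfolding \<A>_def by (rule finite_subset[of _ "Pow {1..n}"]) auto
  have C_eq: "C A = {x \<in> space ?B. \<forall>i\<in>{1..n}. x i \<in> {i \<in> A}}" for A
    by (simp add: C_def space_PiM)
  have sets: "C A \<in> sets ?B" for A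
    unfolding C_eq by (intro sets.sets_Collect_finite_All sets_Collect_single) auto
  have mC: "measure ?B (C A) = p ^ k * (1 - p) ^ (n - k)" if "A \<in> \<A>" for A
  proof -
    have A: "A \<subseteq> {1..n}" "card A = k"
      using that by (auto simp: \<A>_def)
    have "emeasure ?B (C A) = (\<Prod>i\<in>{1..n}. emeasure (measure_pmf (bernoulli_pmf p)) {i \<in> A})"
      unfolding C_eq by (rule emeasure_PiM_Collect) auto
    also have "\<dots> = ennreal (\<Prod>i\<in>{1..n}. pmf (bernoulli_pmf p) (i \<in> A))"
      by (subst prod_ennreal[symmetric]) (auto simp: emeasure_pmf_single)
    also have "(\<Prod>i\<in>{1..n}. pmf (bernoulli_pmf p) (i \<in> A)) = (\<Prod>i\<in>{1..n}. if i \<in> A then p else 1 - p)"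
      using p by (intro prod.cong) auto
    also have "\<dots> = p ^ card ({1..n} \<inter> A) * (1 - p) ^ card ({1..n} \<inter> - A)"
      by (simp add: prod.If_cases)
    also have "{1..n} \<inter> A = A"
      using A by auto
    also have "card ({1..n} \<inter> - A) = n - k"
      using A card_Diff_subset[of A "{1..n}"] finite_subset[of A "{1..n}"]
      by (simp add: Diff_eq)
    finally show ?thesis
      using p A by (simp add: measure_def)
  qed
  have "{x. (\<Sum>i = 1..n. of_bool (x i)) = k} = (\<Union>A\<in>\<A>. C A)"
  proof (intro equalityI subsetI)
    fix x :: "nat \<Rightarrow> bool" assume "x \<in> {x. (\<Sum>i = 1..n. of_bool (x i)) = k}"
    then have "{1..n} \<inter> {i. x i} \<in> \<A>" "x \<in> C ({1..n} \<inter> {i. x i})"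
      by (auto simp: \<A>_def C_def sum_of_bool_eq)
    then show "x \<in> (\<Union>A\<in>\<A>. C A)" by blast
  next
    fix x assume "x \<in> (\<Union>A\<in>\<A>. C A)"
    then obtain A where A: "A \<subseteq> {1..n}" "card A = k" "x \<in> C A"
      by (auto simp: \<A>_def)
    then have "{1..n} \<inter> {i. x i} = A"
      by (auto simp: C_def)
    with A show "x \<in> {x. (\<Sum>i = 1..n. of_bool (x i)) = k}"
      by (simp add: sum_of_bool_eq)
  qed
  also have "measure ?B \<dots> = (\<Sum>A\<in>\<A>. measure ?B (C A))"
  proof (rule P.finite_measure_finite_Union[OF fin])
    show "disjoint_family_on C \<A>"
      unfolding disjoint_family_on_def
    proof (intro ballI impI)
      fix A A' assume "A \<in> \<A>" "A' \<in> \<A>" "A \<noteq> A'"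
      then obtain i where "i \<in> {1..n}" "(i \<in> A) \<noteq> (i \<in> A')"
        unfolding \<A>_def by blast
      then show "C A \<inter> C A' = {}"
        unfolding C_def by force
    qed
  qed (use sets in auto)
  also have "\<dots> = real (card \<A>) * (p ^ k * (1 - p) ^ (n - k))"
    by (simp add: mC)
  also have "card \<A> = n choose k"
    unfolding \<A>_def using n_subsets[of "{1..n}" k] by simp
  finally show ?thesis by simp
qed

lemma (in prob_space)
  assumes [measurable]: "D \<in> measurable M (count_space UNIV)"
  shows prob_space_thinning_law: "prob_space (thinning_law M D p)"
    and sets_thinning_law [simp]: "sets (thinning_law M D p) = UNIV"
    and space_thinning_law [simp]: "space (thinning_law M D p) = UNIV"
    and measure_thinning_law: "0 < p \<Longrightarrow> p < 1 \<Longrightarrow>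
      measure (thinning_law M D p) {k} = thinned_mass (\<lambda>n. prob (D -` {n} \<inter> space M)) k p"
proof -
  let ?B = "\<Pi>\<^sub>M i\<in>(UNIV :: nat set). measure_pmf (bernoulli_pmf p)"
  let ?f = "\<lambda>(\<omega>, x). \<Sum>i = 1..D \<omega>. of_bool (x i) :: nat"
  interpret B: prob_space ?B
    by (intro prob_space_PiM) (simp add: measure_pmf.prob_space_axioms)
  interpret MB: pair_prob_space M ?B ..
  note measurable_PiM_bernoulli_component[measurable]
  have f: "?f \<in> measurable (M \<Otimes>\<^sub>M ?B) (count_space UNIV)"
    by measurable
  show "prob_space (thinning_law M D p)"
    unfolding thinning_law_def by (rule MB.prob_space_distr[OF f])
  show "sets (thinning_law M D p) = UNIV" "space (thinning_law M D p) = UNIV"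
    by (simp_all add: thinning_law_def)
  assume p: "0 < p" "p < 1"
  \<comment> \<open>conditioning on the value of \<open>D\<close> splits the event into measurable rectangles\<close>
  define R where "R n = (D -` {n} \<inter> space M) \<times> {x. (\<Sum>i = 1..n. of_bool (x i)) = k}" for n
  let ?a = "\<lambda>n. prob (D -` {n} \<inter> space M)"
  have sp: "space ?B = UNIV"
    by (simp add: space_PiM)
  have cnt: "{x. (\<Sum>i = 1..n. of_bool (x i)) = k} \<in> sets ?B" for n
  proof -
    have "(\<lambda>x. \<Sum>i = 1..n. of_bool (x i) :: nat) \<in> measurable ?B (count_space UNIV)"
      by measurable
    from measurable_sets[OF this, of "{k}"] show ?thesis
      by (simp add: sp vimage_def)
  qed
  have setsR: "R n \<in> sets (M \<Otimes>\<^sub>M ?B)" for n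
    unfolding R_def using cnt by (intro pair_measureI) auto
  have R: "measure (M \<Otimes>\<^sub>M ?B) (R n) = ?a n * (real (n choose k) * p ^ k * (1 - p) ^ (n - k))" for n
    unfolding R_def measure_bernoulli_count[OF p, symmetric]
    using cnt by (simp add: measure_def B.emeasure_pair_measure_Times enn2real_mult)
  have "measure (thinning_law M D p) {k} = measure (M \<Otimes>\<^sub>M ?B) (?f -` {k} \<inter> space (M \<Otimes>\<^sub>M ?B))"
    unfolding thinning_law_def by (rule measure_distr[OF f]) auto
  also have "?f -` {k} \<inter> space (M \<Otimes>\<^sub>M ?B) = (\<Union>n. R n)"
    by (auto simp: R_def space_pair_measure sp)
  finally have law: "measure (thinning_law M D p) {k} = measure (M \<Otimes>\<^sub>M ?B) (\<Union>n. R n)" .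
  have "(\<lambda>n. measure (M \<Otimes>\<^sub>M ?B) (R n)) sums measure (M \<Otimes>\<^sub>M ?B) (\<Union>n. R n)"
    using setsR by (intro MB.finite_measure_UNION) (auto simp: disjoint_family_on_def R_def)
  then have "(\<lambda>n. ?a n * (real (n choose k) * p ^ k * (1 - p) ^ (n - k))) sums
      measure (thinning_law M D p) {k}"
    unfolding R law .
  then have "(\<lambda>j. ?a (j + k) * (real ((j + k) choose k) * p ^ k * (1 - p) ^ j)) sums
      measure (thinning_law M D p) {k}"
    by (subst (asm) sums_zero_iff_shift[of k, symmetric]) (auto simp: binomial_eq_0)
  then have "(\<lambda>j. (1 / p ^ k) * (?a (j + k) * (real ((j + k) choose k) * p ^ k * (1 - p) ^ j))) sums
      ((1 / p ^ k) * measure (thinning_law M D p) {k})"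
    by (rule sums_mult)
  then have "(\<lambda>j. ?a (j + k) * real ((j + k) choose k) * (1 - p) ^ j) sums
      (measure (thinning_law M D p) {k} / p ^ k)"
    using p by (simp add: field_simps)
  then have "(\<Sum>j. ?a (j + k) * real ((j + k) choose k) * (1 - p) ^ j) =
      measure (thinning_law M D p) {k} / p ^ k"
    by (rule sums_unique[symmetric])
  then show "measure (thinning_law M D p) {k} = thinned_mass ?a k p"
    using p by (simp add: thinned_mass_def)
qed

lemma (in prob_space) mass_sums_1:
  assumes [measurable]: "D \<in> measurable M (count_space UNIV)"
  shows "(\<lambda>n::nat. prob (D -` {n} \<inter> space M)) sums 1"
proof -
  have "(\<lambda>n. prob (D -` {n} \<inter> space M)) sums prob (\<Union>n. D -` {n} \<inter> space M)"
    by (rule finite_measure_UNION) (auto simp: disjoint_family_on_def)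
  also have "(\<Union>n. D -` {n} \<inter> space M) = space M"
    by auto
  finally show ?thesis
    by (simp add: prob_space)
qed


section \<open>Masses and tails of the thinning as functions of the retention probability\<close>

context prob_space
begin

context
  fixes D :: "'a \<Rightarrow> nat"
  assumes D [measurable]: "D \<in> measurable M (count_space UNIV)"
begin

lemma measure_thinning_law_tail_0: "measure (thinning_law M D p) {0..} = 1"
  using prob_space.prob_space[OF prob_space_thinning_law[OF D]] D by simp

lemma measure_thinning_law_tail_Suc:
  "measure (thinning_law M D p) {Suc k..} =
    measure (thinning_law M D p) {k..} - measure (thinning_law M D p) {k}"
proof -
  interpret T: prob_space "thinning_law M D p"
    by (rule prob_space_thinning_law[OF D])
  have "{Suc k..} = {k..} - {k}"
    by auto
  then show ?thesis
    using D by (simp add: T.finite_measure_Diff)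
qed

lemma DERIV_measure_thinning_law:
  assumes p: "0 < p" "p < 1"
  shows "DERIV (\<lambda>p. measure (thinning_law M D p) {k}) p :>
    (real k * measure (thinning_law M D p) {k} -
      real (Suc k) * measure (thinning_law M D p) {Suc k}) / p"
proof -
  let ?a = "\<lambda>n. prob (D -` {n} \<inter> space M)"
  have "DERIV (thinned_mass ?a k) p :>
      (real k * thinned_mass ?a k p - real (Suc k) * thinned_mass ?a (Suc k) p) / p"
    using p sums_summable[OF mass_sums_1[OF D]] by (intro DERIV_thinned_mass) auto
  then show ?thesis
    unfolding measure_thinning_law[OF D p]
    by (rule has_field_derivative_transform_within_open[of _ _ _ "{0<..<1}"])
      (use p in \<open>auto simp: measure_thinning_law[OF D]\<close>)
qed

text \<open>
  The tail at \<open>k\<close> is \<open>1\<close> minus the masses below \<open>k\<close>, and the sum of their derivatives telescopes.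
  So the derivative of the tail involves one mass only.
\<close>

lemma DERIV_thinning_law_tail:
  assumes p: "0 < p" "p < 1"
  shows "DERIV (\<lambda>p. measure (thinning_law M D p) {k..}) p :>
    real k * measure (thinning_law M D p) {k} / p"
proof (induction k)
  case 0
  then show ?case
    by (simp only: measure_thinning_law_tail_0) simp
next
  case (Suc k)
  from DERIV_diff[OF this DERIV_measure_thinning_law[OF p, of k]]
  show ?case
    unfolding measure_thinning_law_tail_Suc
    by (simp add: diff_divide_distrib)
qed

text \<open>
  The event \<open>S \<ge> k\<close> is contained in \<open>S \<noteq> 0\<close>, whose probability is \<open>1 - G(1 - p)\<close> for the generating
  function \<open>G\<close> of \<open>D\<close>.
\<close>

lemma thinning_law_tail_tendsto_0:
  assumes "k \<ge> 1"
  shows "((\<lambda>p. measure (thinning_law M D p) {k..}) \<longlongrightarrow> 0) (at_right 0)"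
proof (rule tendsto_sandwich[OF _ _ tendsto_const])
  let ?a = "\<lambda>n. prob (D -` {n} \<inter> space M)"
  note a = mass_sums_1[OF D]
  have "(thinned_mass ?a 0 \<longlongrightarrow> 1) (at_right 0)"
    using thinned_mass_0_tendsto[of ?a] a by (simp add: sums_iff)
  then show "((\<lambda>p. 1 - thinned_mass ?a 0 p) \<longlongrightarrow> 0) (at_right 0)"
    by (auto intro!: tendsto_eq_intros)
  have "measure (thinning_law M D p) {k..} \<le> 1 - thinned_mass ?a 0 p" if "0 < p" "p < 1" for p
  proof -
    interpret T: prob_space "thinning_law M D p"
      by (rule prob_space_thinning_law[OF D])
    have "measure (thinning_law M D p) {k..} \<le> measure (thinning_law M D p) {Suc 0..}"
      using assms D by (intro T.finite_measure_mono) auto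
    also have "\<dots> = 1 - thinned_mass ?a 0 p"
      using measure_thinning_law_tail_Suc[of p 0] measure_thinning_law_tail_0[of p]
        measure_thinning_law[OF D that, of 0] by simp
    finally show ?thesis .
  qed
  then show "\<forall>\<^sub>F p in at_right 0. measure (thinning_law M D p) {k..} \<le> 1 - thinned_mass ?a 0 p"
    using eventually_at_right_real[of 0 1] by (auto elim!: eventually_mono)
qed auto

lemma thinning_law_mass_tendsto_0:
  assumes "k \<ge> 1"
  shows "((\<lambda>p. measure (thinning_law M D p) {k}) \<longlongrightarrow> 0) (at_right 0)"
proof (rule tendsto_sandwich[OF _ _ tendsto_const thinning_law_tail_tendsto_0[OF assms]])
  have "measure (thinning_law M D p) {k} \<le> measure (thinning_law M D p) {k..}" for p
  proof -
    interpret T: prob_space "thinning_law M D p"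
      by (rule prob_space_thinning_law[OF D])
    show ?thesis
      using D by (intro T.finite_measure_mono) auto
  qed
  then show "\<forall>\<^sub>F p in at_right 0.
      measure (thinning_law M D p) {k} \<le> measure (thinning_law M D p) {k..}"
    by simp
qed auto

end

end


section \<open>The ratio of a tail to a mass\<close>

text \<open>
  Here \<open>f\<close> and \<open>F\<close> are the mass and the tail at \<open>\<kappa>\<close>, and \<open>g\<close> is \<open>\<kappa> + 1\<close> times the next mass. The
  last hypothesis means that \<open>p f' / f\<close> tends to \<open>\<alpha>\<close>, that is, that \<open>f\<close> behaves like a power
  \<open>p\<^sup>\<alpha>\<close> up to a slowly varying factor. Then \<open>F\<close>, the integral of \<open>\<kappa> f(q) / q\<close> over
  \<open>0 < q < p\<close>, is asymptotic to \<open>\<kappa> f(p) / \<alpha>\<close>, as for a true power. L'Hopital's rule replaces the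
  theory of regular variation: the quotient of the derivatives is \<open>\<kappa> / (\<kappa> - g / f)\<close>.
\<close>

lemma tail_over_mass_tendsto:
  fixes F f g :: "real \<Rightarrow> real"
  assumes "\<alpha> > 0"
    and lims: "(F \<longlongrightarrow> 0) (at_right 0)" "(f \<longlongrightarrow> 0) (at_right 0)"
    and pos: "\<forall>\<^sub>F p in at_right 0. f p > 0"
    and F': "\<forall>\<^sub>F p in at_right 0. DERIV F p :> \<kappa> * f p / p"
    and f': "\<forall>\<^sub>F p in at_right 0. DERIV f p :> (\<kappa> * f p - g p) / p"
    and ratio: "((\<lambda>p. g p / f p) \<longlongrightarrow> \<kappa> - \<alpha>) (at_right 0)"
  shows "((\<lambda>p. F p / f p) \<longlongrightarrow> \<kappa> / \<alpha>) (at_right 0)"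
proof (rule lhopital_right_0[OF lims])
  have p: "\<forall>\<^sub>F p in at_right 0. 0 < (p::real)"
    by (simp add: eventually_at_right_less)
  have exponent: "((\<lambda>p. \<kappa> - g p / f p) \<longlongrightarrow> \<alpha>) (at_right 0)"
    using tendsto_diff[OF tendsto_const[of \<kappa>] ratio] by simp
  then have "\<forall>\<^sub>F p in at_right 0. \<kappa> - g p / f p > 0"
    using \<open>\<alpha> > 0\<close> by (rule order_tendstoD)
  with p pos have ev: "\<forall>\<^sub>F p in at_right 0. 0 < p \<and> 0 < f p \<and> \<kappa> - g p / f p > 0"
    by eventually_elim auto
  show "\<forall>\<^sub>F p in at_right 0. f p \<noteq> 0"
    using pos by eventually_elim auto
  show "\<forall>\<^sub>F p in at_right 0. (\<kappa> * f p - g p) / p \<noteq> 0"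
    using ev by eventually_elim (auto simp: field_simps)
  have "((\<lambda>p. \<kappa> / (\<kappa> - g p / f p)) \<longlongrightarrow> \<kappa> / \<alpha>) (at_right 0)"
    using \<open>\<alpha> > 0\<close> by (intro tendsto_divide tendsto_const exponent) auto
  moreover have "\<forall>\<^sub>F p in at_right 0.
      \<kappa> / (\<kappa> - g p / f p) = (\<kappa> * f p / p) / ((\<kappa> * f p - g p) / p)"
    using ev by eventually_elim (auto simp: divide_simps)
  ultimately show "((\<lambda>p. (\<kappa> * f p / p) / ((\<kappa> * f p - g p) / p)) \<longlongrightarrow> \<kappa> / \<alpha>) (at_right 0)"
    by (rule Lim_transform_eventually)
qed (use F' f' in auto)


section \<open>The limit law\<close>

text \<open>
  The tail function of the limit law, for \<open>0 < \<alpha> \<le> m\<close>. The empty product gives the value \<open>1\<close> for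
  every \<open>k \<le> m\<close>, as it should be for a law on \<open>{m..}\<close>.
\<close>

definition ratio_tail :: "nat \<Rightarrow> real \<Rightarrow> nat \<Rightarrow> real" where
  "ratio_tail m \<alpha> k = (\<Prod>j = m..<k. 1 - \<alpha> / real j)"

lemma ratio_tail_eq_1: "k \<le> m \<Longrightarrow> ratio_tail m \<alpha> k = 1"
  by (simp add: ratio_tail_def)

lemma ratio_tail_Suc: "m \<le> k \<Longrightarrow> ratio_tail m \<alpha> (Suc k) = ratio_tail m \<alpha> k * (1 - \<alpha> / real k)"
  by (simp add: ratio_tail_def prod.atLeastLessThan_Suc)

context
  fixes m :: nat and \<alpha> :: real
  assumes \<alpha>: "0 < \<alpha>" "\<alpha> \<le> real m"
begin

lemma ratio_tail_nonneg: "0 \<le> ratio_tail m \<alpha> k"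
  unfolding ratio_tail_def using \<alpha> by (intro prod_nonneg) auto

lemma ratio_tail_pos: "\<alpha> < real m \<Longrightarrow> 0 < ratio_tail m \<alpha> k"
  unfolding ratio_tail_def using \<alpha> by (intro prod_pos) auto

lemma ratio_tail_diff:
  "ratio_tail m \<alpha> k - ratio_tail m \<alpha> (Suc k) = (if k < m then 0 else ratio_tail m \<alpha> k * \<alpha> / real k)"
  by (simp add: ratio_tail_eq_1 ratio_tail_Suc algebra_simps)

lemma decseq_ratio_tail: "decseq (ratio_tail m \<alpha>)"
proof (rule decseq_SucI)
  have "0 \<le> ratio_tail m \<alpha> k - ratio_tail m \<alpha> (Suc k)" for k
    unfolding ratio_tail_diff using \<alpha> ratio_tail_nonneg by simp
  then show "ratio_tail m \<alpha> (Suc k) \<le> ratio_tail m \<alpha> k" for k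
    by simp
qed

text \<open>
  The increments \<open>T\<^sub>k - T\<^sub>k\<^sub>+\<^sub>1 = T\<^sub>k \<alpha> / k\<close> are summable by telescoping. A positive limit \<open>L\<close> would
  make them at least \<open>L \<alpha> / k\<close>, against the divergence of the harmonic series.
\<close>

lemma ratio_tail_tendsto_0: "ratio_tail m \<alpha> \<longlonglongrightarrow> 0"
proof -
  obtain L where lim: "ratio_tail m \<alpha> \<longlonglongrightarrow> L" and L: "\<And>k. L \<le> ratio_tail m \<alpha> k"
    using decseq_convergent[OF decseq_ratio_tail, of 0] ratio_tail_nonneg by metis
  have "L = 0"
  proof (rule ccontr)
    assume "L \<noteq> 0"
    moreover have "0 \<le> L"
      using LIMSEQ_le_const[OF lim] ratio_tail_nonneg by blast
    ultimately have "0 < L" by simp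
    have "summable (\<lambda>k. L * \<alpha> * inverse (real k))"
    proof (rule summable_comparison_test')
      show "summable (\<lambda>k. ratio_tail m \<alpha> k - ratio_tail m \<alpha> (Suc k))"
        by (rule telescope_summable'[OF lim])
      show "norm (L * \<alpha> * inverse (real k)) \<le> ratio_tail m \<alpha> k - ratio_tail m \<alpha> (Suc k)" if "m \<le> k" for k
        using that \<alpha> \<open>0 < L\<close> L[of k] unfolding ratio_tail_diff
        by (simp add: abs_mult divide_inverse mult_right_mono)
    qed
    then show False
      using \<open>0 < L\<close> \<alpha> not_summable_harmonic[where 'a = real] by (simp add: summable_cmult_iff)
  qed
  with lim show ?thesis by simp
qed

end

lemma pmf_nat_tail_Suc:
  "measure (measure_pmf \<mu>) {Suc k..} = measure (measure_pmf \<mu>) {k..} - pmf \<mu> k" for k :: nat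
proof -
  have "{Suc k..} = {k..} - {k}"
    by auto
  then show ?thesis
    by (simp add: measure_pmf.finite_measure_Diff pmf.rep_eq)
qed

lemma exists_pmf_with_tails:
  fixes T :: "nat \<Rightarrow> real"
  assumes T: "T 0 = 1" "decseq T" "T \<longlonglongrightarrow> 0"
  shows "\<exists>\<mu>. \<forall>k. measure (measure_pmf \<mu>) {k..} = T k"
proof -
  let ?f = "\<lambda>k. T k - T (Suc k)"
  have f: "0 \<le> ?f k" for k
    using decseqD[OF T(2), of k "Suc k"] by simp
  have sums: "?f sums 1"
    using telescope_sums'[OF T(3)] T(1) by simp
  have "(\<integral>\<^sup>+ k. ennreal (?f k) \<partial>count_space UNIV) = (\<Sum>k. ennreal (?f k))"
    by (rule nn_integral_count_space_nat)
  also have "\<dots> = 1"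
    using suminf_ennreal_eq[OF f sums] by simp
  finally have pmf: "pmf (embed_pmf ?f) k = ?f k" for k
    using f by (intro pmf_embed_pmf) auto
  have "measure (measure_pmf (embed_pmf ?f)) {k..} = T k" for k
  proof (induction k)
    case 0
    then show ?case by (simp add: T(1))
  next
    case (Suc k)
    then show ?case by (simp add: pmf_nat_tail_Suc pmf)
  qed
  then show ?thesis by blast
qed

lemma has_ratio_law_of_tails:
  assumes \<alpha>: "0 < \<alpha>" "\<alpha> < real m"
    and tails: "\<And>k. measure (measure_pmf \<mu>) {k..} = ratio_tail m \<alpha> k"
  shows "has_ratio_law m \<alpha> \<mu>"
proof -
  have pmf: "pmf \<mu> k = (if k < m then 0 else ratio_tail m \<alpha> k * \<alpha> / real k)" for k
    using ratio_tail_diff[of \<alpha> m k] pmf_nat_tail_Suc[of \<mu> k] \<alpha> by (simp add: tails)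
  have "pmf \<mu> (k + 1) / pmf \<mu> k = (real k - \<alpha>) / (real k + 1)" if "m \<le> k" for k
  proof -
    have "0 < real k" "0 < ratio_tail m \<alpha> k"
      using that \<alpha> ratio_tail_pos[of \<alpha> m k] by auto
    then have "pmf \<mu> (k + 1) = pmf \<mu> k * ((real k - \<alpha>) / (real k + 1))" "0 < pmf \<mu> k"
      using that \<alpha> by (simp_all add: pmf ratio_tail_Suc divide_simps)
    then show ?thesis
      by simp
  qed
  moreover have "set_pmf \<mu> \<subseteq> {m..}"
    by (auto simp: set_pmf_iff pmf not_less split: if_splits)
  moreover have "pmf \<mu> m > 0"
    using \<alpha> by (simp add: pmf ratio_tail_eq_1)
  ultimately show ?thesis
    by (simp add: has_ratio_law_def)
qed

text \<open>
  The ratios determine every mass from the one at \<open>m\<close>, so two such laws are proportional, and both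
  have total mass \<open>1\<close>.
\<close>

lemma has_ratio_law_unique:
  assumes \<alpha>: "\<alpha> < real m" and \<mu>: "has_ratio_law m \<alpha> \<mu>" and \<nu>: "has_ratio_law m \<alpha> \<nu>"
  shows "\<mu> = \<nu>"
proof -
  have recurrence: "pmf \<xi> (Suc k) = (real k - \<alpha>) / (real k + 1) * pmf \<xi> k"
    if "has_ratio_law m \<alpha> \<xi>" "m \<le> k" for \<xi> k
  proof -
    have ratio: "pmf \<xi> (Suc k) / pmf \<xi> k = (real k - \<alpha>) / (real k + 1)"
      using that by (simp add: has_ratio_law_def)
    moreover have "(real k - \<alpha>) / (real k + 1) \<noteq> 0"
      using that \<alpha> by simp
    \<comment> \<open>if \<open>pmf \<xi> k\<close> were \<open>0\<close>, the quotient would be \<open>0\<close> by the convention \<open>x / 0 = 0\<close>\<close>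
    ultimately have "pmf \<xi> k \<noteq> 0"
      by auto
    then show ?thesis
      using ratio by (simp add: divide_eq_eq)
  qed
  define c where "c = pmf \<nu> m / pmf \<mu> m"
  have pos: "pmf \<mu> m > 0"
    using \<mu> by (simp add: has_ratio_law_def)
  have scaled: "pmf \<nu> k = c * pmf \<mu> k" for k
  proof (cases "m \<le> k")
    case True
    then show ?thesis
    proof (induction k rule: dec_induct)
      case base
      then show ?case using pos by (simp add: c_def)
    next
      case (step k)
      then show ?case
        by (simp add: recurrence[OF \<mu>] recurrence[OF \<nu>])
    qed
  next
    case False
    then have "k \<notin> set_pmf \<mu>" "k \<notin> set_pmf \<nu>"
      using \<mu> \<nu> by (auto simp: has_ratio_law_def)
    then show ?thesis
      by (simp add: set_pmf_iff)
  qed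
  have "0 \<le> c"
    by (simp add: c_def)
  have "1 = (\<integral>\<^sup>+ k. ennreal (pmf \<nu> k) \<partial>count_space UNIV)"
    by (rule nn_integral_pmf_eq_1[symmetric])
  also have "\<dots> = (\<integral>\<^sup>+ k. ennreal c * ennreal (pmf \<mu> k) \<partial>count_space UNIV)"
    using \<open>0 \<le> c\<close> by (simp add: scaled ennreal_mult)
  also have "\<dots> = ennreal c"
    by (simp add: nn_integral_cmult nn_integral_pmf_eq_1)
  finally have "c = 1"
    by (metis ennreal_eq_1)
  then show ?thesis
    by (intro pmf_eqI) (simp add: scaled)
qed

text \<open>For \<open>\<alpha> = m\<close> the first factor \<open>1 - \<alpha> / m\<close> of the product vanishes.\<close>

lemma return_pmf_tails:
  assumes "m \<ge> 1"
  shows "measure (measure_pmf (return_pmf m)) {k..} = ratio_tail m (real m) k"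
proof (cases "k \<le> m")
  case True
  then show ?thesis by (simp add: ratio_tail_eq_1 measure_return)
next
  case False
  then have "ratio_tail m (real m) k = 0"
    using assms unfolding ratio_tail_def by (intro prod_zero) (auto intro!: bexI[of _ m])
  with False show ?thesis by (simp add: measure_return)
qed


section \<open>Convergence in distribution through tails\<close>

lemma cdf_distr_real_of_nat:
  fixes N :: "nat measure"
  assumes "prob_space N" "sets N = UNIV"
  shows "cdf (distr N borel real) x = 1 - measure N {nat (\<lfloor>x\<rfloor> + 1)..}"
proof -
  interpret prob_space N by fact
  have space: "space N = UNIV"
    using sets_eq_imp_space_eq[of N "count_space UNIV"] assms by simp
  have meas: "real \<in> measurable N borel"
    by (simp add: measurable_def space assms)
  have "cdf (distr N borel real) x = measure N {n. real n \<le> x}"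
    unfolding cdf_def by (subst measure_distr[OF meas]) (auto simp: space vimage_def)
  also have "{n. real n \<le> x} = space N - {nat (\<lfloor>x\<rfloor> + 1)..}"
    by (auto simp: space) linarith+
  also have "measure N \<dots> = 1 - measure N {nat (\<lfloor>x\<rfloor> + 1)..}"
    using assms by (intro prob_compl) simp
  finally show ?thesis .
qed

lemma nat_conv_in_distribution_of_tails:
  fixes N :: "'i \<Rightarrow> nat measure"
  assumes N: "\<forall>\<^sub>F i in F. prob_space (N i) \<and> sets (N i) = UNIV"
    and tails: "\<And>k. ((\<lambda>i. measure (N i) {k..}) \<longlongrightarrow> measure (measure_pmf \<mu>) {k..}) F"
  shows "nat_conv_in_distribution N \<mu> F"
  unfolding nat_conv_in_distribution_def conv_in_distribution_def
proof (intro allI impI)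
  fix x :: real
  have "\<forall>\<^sub>F i in F. 1 - measure (N i) {nat (\<lfloor>x\<rfloor> + 1)..} = cdf (distr (N i) borel real) x"
    using N by eventually_elim (simp add: cdf_distr_real_of_nat)
  with tendsto_diff[OF tendsto_const tails]
  have "((\<lambda>i. cdf (distr (N i) borel real) x) \<longlongrightarrow>
      1 - measure (measure_pmf \<mu>) {nat (\<lfloor>x\<rfloor> + 1)..}) F"
    by (rule Lim_transform_eventually)
  then show "((\<lambda>i. cdf (distr (N i) borel real) x) \<longlongrightarrow>
      cdf (distr (measure_pmf \<mu>) borel real) x) F"
    by (simp add: cdf_distr_real_of_nat measure_pmf.prob_space_axioms)
qed


section \<open>Tightness and the limit of the conditional laws\<close>

theorem theorem3:
  fixes \<beta> :: real and m :: nat and M :: "'a measure" and D :: "'a \<Rightarrow> nat"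
  assumes "\<beta> > 1" and "m \<ge> 1" and "real m \<ge> \<beta> - 1"
    and "prob_space M" and "D \<in> measurable M (count_space UNIV)"
    and "\<And>(k::nat) (p::real). real k \<ge> \<beta> \<Longrightarrow> 0 < p \<Longrightarrow> p < 1 \<Longrightarrow>
           measure (thinning_law M D p) {k - 1} > 0"
    and "\<And>k::nat. real k \<ge> \<beta> \<Longrightarrow>
           ((\<lambda>p. measure (thinning_law M D p) {k} / measure (thinning_law M D p) {k - 1})
              \<longlongrightarrow> (real k - \<beta>) / real k) (at_right 0)"
  shows "((\<lambda>k. Limsup (at_right 0) (\<lambda>p. ereal (measure (thinning_law M D p) {k..} /
                 measure (thinning_law M D p) {m..}))) \<longlonglongrightarrow> 0)
    \<and> (\<exists>\<mu>. nat_conv_in_distribution (thinning_cond_law M D m) \<mu> (at_right 0))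
    \<and> (\<beta> < real m + 1 \<longrightarrow>
         (\<exists>!\<mu>. has_ratio_law m (\<beta> - 1) \<mu>) \<and>
         (\<forall>\<mu>. has_ratio_law m (\<beta> - 1) \<mu> \<longrightarrow>
            nat_conv_in_distribution (thinning_cond_law M D m) \<mu> (at_right 0)))
    \<and> (\<beta> = real m + 1 \<longrightarrow>
         nat_conv_in_distribution (thinning_cond_law M D m) (return_pmf m) (at_right 0))"
proof -
  interpret prob_space M by fact
  note D = assms(5)
  define \<alpha> where "\<alpha> = \<beta> - 1"
  have \<alpha>: "0 < \<alpha>" "\<alpha> \<le> real m"
    using assms by (auto simp: \<alpha>_def)
  define f where "f k p = measure (thinning_law M D p) {k}" for k p
  define F where "F k p = measure (thinning_law M D p) {k..}" for k p
  let ?T = "ratio_tail m \<alpha>"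
  have unit: "\<forall>\<^sub>F p in at_right 0. 0 < p \<and> p < (1::real)"
    using eventually_at_right_real[of 0 1] by simp
  \<comment> \<open>\<open>k \<ge> m\<close> gives \<open>k + 1 \<ge> \<beta>\<close>, so the hypotheses apply to \<open>k + 1\<close>\<close>
  have f_pos: "0 < f k p" if "m \<le> k" "0 < p" "p < 1" for k p
    using assms(6)[of "Suc k" p] that \<alpha> by (simp add: f_def \<alpha>_def)
  have f_le_F: "f k p \<le> F k p" for k p
  proof -
    interpret T: prob_space "thinning_law M D p"
      by (rule prob_space_thinning_law[OF D])
    show ?thesis
      unfolding f_def F_def using D by (intro T.finite_measure_mono) auto
  qed
  have F_pos: "0 < F k p" if "m \<le> k" "0 < p" "p < 1" for k p
    using f_pos[OF that] f_le_F by (rule less_le_trans)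
  have tail_step: "((\<lambda>p. F (Suc k) p / F k p) \<longlongrightarrow> 1 - \<alpha> / real k) (at_right 0)" if k: "m \<le> k" for k
  proof -
    have "((\<lambda>p. f (Suc k) p / f k p) \<longlongrightarrow> (real (Suc k) - \<beta>) / real (Suc k)) (at_right 0)"
      using assms(7)[of "Suc k"] \<alpha> k by (simp add: f_def \<alpha>_def)
    from tendsto_mult[OF tendsto_const[of "real (Suc k)"] this]
    have ratio: "((\<lambda>p. real (Suc k) * f (Suc k) p / f k p) \<longlongrightarrow> real k - \<alpha>) (at_right 0)"
      by (simp add: \<alpha>_def diff_diff_eq2 add.commute)
    have "((\<lambda>p. F k p / f k p) \<longlongrightarrow> real k / \<alpha>) (at_right 0)"
    proof (rule tail_over_mass_tendsto[OF \<alpha>(1) _ _ _ _ _ ratio])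
      show "(F k \<longlongrightarrow> 0) (at_right 0)" "(f k \<longlongrightarrow> 0) (at_right 0)"
        using thinning_law_tail_tendsto_0[OF D] thinning_law_mass_tendsto_0[OF D] k assms(2)
        by (auto simp: F_def[abs_def] f_def[abs_def])
      show "\<forall>\<^sub>F p in at_right 0. 0 < f k p"
        using unit by eventually_elim (use f_pos k in auto)
      show "\<forall>\<^sub>F p in at_right 0. DERIV (F k) p :> real k * f k p / p"
        using unit unfolding F_def[abs_def] f_def
        by eventually_elim (use DERIV_thinning_law_tail[OF D] in auto)
      show "\<forall>\<^sub>F p in at_right 0. DERIV (f k) p :> (real k * f k p - real (Suc k) * f (Suc k) p) / p"
        using unit unfolding f_def[abs_def]
        by eventually_elim (use DERIV_measure_thinning_law[OF D] in auto)
    qed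
    from tendsto_diff[OF tendsto_const[of 1] tendsto_inverse[OF this]]
    have "((\<lambda>p. 1 - inverse (F k p / f k p)) \<longlongrightarrow> 1 - \<alpha> / real k) (at_right 0)"
      using \<alpha> k by simp
    moreover have "\<forall>\<^sub>F p in at_right 0. 1 - inverse (F k p / f k p) = F (Suc k) p / F k p"
      using unit
    proof eventually_elim
      case (elim p)
      then have "0 < F k p"
        using F_pos k by blast
      moreover have "F (Suc k) p = F k p - f k p"
        unfolding F_def f_def by (rule measure_thinning_law_tail_Suc[OF D])
      ultimately show ?case
        by (simp add: diff_divide_distrib)
    qed
    ultimately show ?thesis
      by (rule Lim_transform_eventually)
  qed
  have tail: "((\<lambda>p. F k p / F m p) \<longlongrightarrow> ?T k) (at_right 0)" if "m \<le> k" for k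
    using that
  proof (induction k rule: dec_induct)
    case base
    have "\<forall>\<^sub>F p in at_right 0. 1 = F m p / F m p"
      using unit by eventually_elim (use F_pos[of m] in force)
    then show ?case
      by (intro Lim_transform_eventually[OF tendsto_const]) (simp_all add: ratio_tail_eq_1)
  next
    case (step k)
    have "((\<lambda>p. F k p / F m p * (F (Suc k) p / F k p)) \<longlongrightarrow> ?T (Suc k)) (at_right 0)"
      unfolding ratio_tail_Suc[OF step.hyps(1)]
      by (intro tendsto_mult step.IH tail_step step.hyps)
    moreover have "\<forall>\<^sub>F p in at_right 0. F k p / F m p * (F (Suc k) p / F k p) = F (Suc k) p / F m p"
      using unit by eventually_elim (use F_pos[OF step.hyps(1)] in force)
    ultimately show ?case
      by (rule Lim_transform_eventually)
  qed
  \<comment> \<open>the conditional tail at \<open>k\<close> is \<open>F k p / F m p\<close> for \<open>k \<ge> m\<close> and \<open>1\<close> for smaller \<open>k\<close>\<close>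
  have conv: "nat_conv_in_distribution (thinning_cond_law M D m) \<mu> (at_right 0)"
    if \<mu>: "\<And>k. measure (measure_pmf \<mu>) {k..} = ?T k" for \<mu>
  proof (rule nat_conv_in_distribution_of_tails)
    have em: "emeasure (thinning_law M D p) {m..} \<noteq> 0 \<and> emeasure (thinning_law M D p) {m..} \<noteq> \<infinity>"
      if "0 < p" "p < 1" for p
    proof -
      interpret T: prob_space "thinning_law M D p"
        by (rule prob_space_thinning_law[OF D])
      show ?thesis
        using F_pos[OF order.refl that] by (simp add: F_def T.emeasure_eq_measure)
    qed
    show "\<forall>\<^sub>F p in at_right 0. prob_space (thinning_cond_law M D m p) \<and>
        sets (thinning_cond_law M D m p) = UNIV"
      using unit
    proof eventually_elim
      case (elim p)
      then have "prob_space (uniform_measure (thinning_law M D p) {m..})"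
        using em by (intro prob_space_uniform_measure) blast+
      then show ?case
        by (simp add: thinning_cond_law_def sets_thinning_law[OF D])
    qed
    fix k
    have "\<forall>\<^sub>F p in at_right 0. F (max m k) p / F m p = measure (thinning_cond_law M D m p) {k..}"
      using unit
    proof eventually_elim
      case (elim p)
      have "{max m k..} = {m..} \<inter> {k..}"
        by (intro set_eqI) simp
      moreover have "measure (thinning_cond_law M D m p) {k..} =
          measure (thinning_law M D p) ({m..} \<inter> {k..}) / measure (thinning_law M D p) {m..}"
        unfolding thinning_cond_law_def
      proof (rule measure_uniform_measure)
        show "{k..} \<in> sets (thinning_law M D p)"
          by (simp add: sets_thinning_law[OF D])
      qed (use em[of p] elim in simp_all)
      ultimately show ?case
        by (simp only: F_def)
    qed
    with tail[OF max.cobounded1]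
    have "((\<lambda>p. measure (thinning_cond_law M D m p) {k..}) \<longlongrightarrow> ?T (max m k)) (at_right 0)"
      by (rule Lim_transform_eventually)
    moreover have "?T (max m k) = ?T k"
      by (cases "m \<le> k") (auto simp: ratio_tail_eq_1)
    ultimately show "((\<lambda>p. measure (thinning_cond_law M D m p) {k..}) \<longlongrightarrow> measure (measure_pmf \<mu>) {k..}) (at_right 0)"
      by (simp add: \<mu>)
  qed
  obtain \<mu> where \<mu>: "\<And>k. measure (measure_pmf \<mu>) {k..} = ?T k"
    using exists_pmf_with_tails[of ?T] decseq_ratio_tail[OF \<alpha>] ratio_tail_tendsto_0[OF \<alpha>]
    by (auto simp: ratio_tail_eq_1)
  have "(\<lambda>k. Limsup (at_right 0) (\<lambda>p. ereal (F k p / F m p))) \<longlonglongrightarrow> 0"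
  proof (rule Lim_transform_eventually)
    show "(\<lambda>k. ereal (?T k)) \<longlonglongrightarrow> 0"
      using ratio_tail_tendsto_0[OF \<alpha>] by (simp add: zero_ereal_def)
    have "ereal (?T k) = Limsup (at_right 0) (\<lambda>p. ereal (F k p / F m p))" if "m \<le> k" for k
      using tail[OF that] by (intro lim_imp_Limsup[symmetric]) auto
    then show "\<forall>\<^sub>F k in sequentially. ereal (?T k) = Limsup (at_right 0) (\<lambda>p. ereal (F k p / F m p))"
      unfolding eventually_sequentially by blast
  qed
  moreover have "(\<exists>!\<mu>. has_ratio_law m \<alpha> \<mu>) \<and> (\<forall>\<nu>. has_ratio_law m \<alpha> \<nu> \<longrightarrow>
      nat_conv_in_distribution (thinning_cond_law M D m) \<nu> (at_right 0))" if "\<alpha> < real m"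
    using has_ratio_law_of_tails[OF \<alpha>(1) that \<mu>] has_ratio_law_unique[OF that] conv[OF \<mu>] by metis
  moreover have "nat_conv_in_distribution (thinning_cond_law M D m) (return_pmf m) (at_right 0)"
    if "\<alpha> = real m"
    using return_pmf_tails[OF assms(2)] that by (intro conv) simp
  ultimately show ?thesis
    using conv[OF \<mu>] by (auto simp: \<alpha>_def F_def algebra_simps)
qed

end
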